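(* Let $S\subseteq\mathbb{N}^p$ be an affine semigroup with $E=\operatorname{Mult}(S)$ and $A=\operatorname{msg}(S)\setminus E$. Then $S$ is strong if and only if the following two conditions hold: for all $a_1,a_2\in A$ with $a_1\ne a_2$ there exists $e_1\in E$ with $a_1+a_2-e_1\in S$; and for every $a_1\in A$ there exists $e_2\in E$ with $3a_1-e_2\in S$.
   Context: Here $p\ge1$ and $\mathbb{N}$ is the set of non-negative integers. An affine semigroup $S\subseteq\mathbb{N}^p$ is a finitely generated submonoid of $\mathbb{N}^p$; $\operatorname{msg}(S)$ is its unique minimal generating set; $\mathcal{C}(S)$ is the set of points of $\mathbb{N}^p$ lying in the cone of non-negative real combinations of $\operatorname{msg}(S)$. The set of multiplicities $\operatorname{Mult}(S)\subseteq\operatorname{msg}(S)$ is the set of minimal elements of $S\setminus\{0\}$ for the order $x\le_{\mathcal{C}(S)}y\iff y-x\in\mathcal{C}(S)$. $S$ is strong if for all $x,y\in S\setminus\{0\}$ with $x\neq y$ there is $e\in\operatorname{Mult}(S)$ with $x+y-e\in S$. *)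

theory Defs
  imports "HOL-Analysis.Analysis"
begin

text \<open>Points of \<open>\<nat>\<^sup>p\<close> are the integer vectors with non-negative entries, so that \<open>x - y\<close> is the
  difference in \<open>\<int>\<^sup>p\<close> rather than a truncated one. The index type \<open>'p\<close> is finite and non-empty,
  with \<open>p = CARD('p) \<ge> 1\<close>.\<close>

definition nat_vecs :: "(int ^ 'p) set" where
  "nat_vecs = {x. \<forall>i. 0 \<le> x $ i}"

definition real_vec :: "int ^ 'p \<Rightarrow> real ^ 'p" where
  "real_vec x = (\<chi> i. real_of_int (x $ i))"

definition submonoid :: "(int ^ 'p) set \<Rightarrow> bool" where
  "submonoid M \<longleftrightarrow> 0 \<in> M \<and> (\<forall>x\<in>M. \<forall>y\<in>M. x + y \<in> M)"

definition affine_semigroup :: "(int ^ 'p) set \<Rightarrow> bool" where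
  "affine_semigroup S \<longleftrightarrow> S \<subseteq> nat_vecs \<and> (\<exists>G. finite G \<and> submonoid hull G = S)"

definition minimal_generating_set :: "(int ^ 'p) set \<Rightarrow> (int ^ 'p) set \<Rightarrow> bool" where
  "minimal_generating_set S G \<longleftrightarrow>
     submonoid hull G = S \<and> (\<forall>H. H \<subset> G \<longrightarrow> submonoid hull H \<noteq> S)"

definition msg :: "(int ^ 'p) set \<Rightarrow> (int ^ 'p) set" where
  "msg S = (THE G. minimal_generating_set S G)"

lemma submonoid_hull: "submonoid (submonoid hull G)"
  by (rule hull_in) (auto simp: submonoid_def)

text \<open>The description in \<^const>\<open>msg\<close> is well defined on affine semigroups.\<close>

lemma ex1_minimal_generating_set:
  fixes S :: "(int ^ 'p) set"
  assumes "affine_semigroup S"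
  shows "\<exists>!G. minimal_generating_set S G"
proof -
  have pos: "S \<subseteq> nat_vecs" and sub: "submonoid S"
    using assms submonoid_hull by (auto simp: affine_semigroup_def)
  define I where "I = {x \<in> S - {0}. \<forall>y\<in>S - {0}. \<forall>z\<in>S - {0}. x \<noteq> y + z}"
  have irreducible: "I \<subseteq> G" if "submonoid hull G = S" for G
  proof
    fix x assume x: "x \<in> I"
    show "x \<in> G"
    proof (rule ccontr)
      assume "x \<notin> G"
      have "submonoid (S - {x})"
        unfolding submonoid_def
      proof (intro conjI ballI)
        show "0 \<in> S - {x}"
          using sub x by (auto simp: submonoid_def I_def)
        fix y z assume yz: "y \<in> S - {x}" "z \<in> S - {x}"
        have "y + z \<noteq> x"
        proof
          assume "y + z = x"
          with yz have "y \<noteq> 0" "z \<noteq> 0" by auto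
          with yz x \<open>y + z = x\<close> show False by (auto simp: I_def)
        qed
        then show "y + z \<in> S - {x}"
          using yz sub by (auto simp: submonoid_def)
      qed
      moreover have "G \<subseteq> S - {x}"
        using \<open>x \<notin> G\<close> that hull_subset[of G submonoid] by auto
      ultimately have "S \<subseteq> S - {x}"
        using that hull_minimal by metis
      then show False
        using x by (auto simp: I_def)
    qed
  qed
  have "x \<in> submonoid hull I" if "x \<in> S" for x
    using that
  proof (induction "nat (\<Sum>i\<in>UNIV. x $ i)" arbitrary: x rule: less_induct)
    case less
    show ?case
    proof (cases "x = 0 \<or> x \<in> I")
      case True
      then show ?thesis
        using submonoid_hull[of I] by (auto simp: submonoid_def intro: hull_inc)
    next
      case False
      then obtain y z where yz: "y \<in> S" "z \<in> S" "y \<noteq> 0" "z \<noteq> 0" "x = y + z"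
        using less.prems by (auto simp: I_def)
      have gt: "(\<Sum>i\<in>UNIV. v $ i) > 0" if v: "v \<in> S" "v \<noteq> 0" for v
      proof -
        have "\<forall>i. 0 \<le> v $ i" using v pos by (auto simp: nat_vecs_def)
        moreover obtain i where "v $ i \<noteq> 0"
          using v by (metis vec_eq_iff zero_index)
        ultimately show ?thesis
          by (intro sum_pos2[where i = i]) (auto simp: order_le_less)
      qed
      have "(\<Sum>i\<in>UNIV. x $ i) = (\<Sum>i\<in>UNIV. y $ i) + (\<Sum>i\<in>UNIV. z $ i)"
        by (simp add: yz(5) sum.distrib)
      then have "y \<in> submonoid hull I" "z \<in> submonoid hull I"
        using less.hyps yz gt[of y] gt[of z] by auto
      then show ?thesis
        using submonoid_hull[of I] yz(5) by (auto simp: submonoid_def)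
    qed
  qed
  moreover have "submonoid hull I \<subseteq> S"
    by (rule hull_minimal) (auto simp: I_def sub)
  ultimately have hull: "submonoid hull I = S" by auto
  show ?thesis
  proof
    show "minimal_generating_set S I"
      unfolding minimal_generating_set_def using hull irreducible by blast
    show "G = I" if "minimal_generating_set S G" for G
      using that hull irreducible[of G] unfolding minimal_generating_set_def by blast
  qed
qed

definition nonneg_combinations :: "(real ^ 'p) set \<Rightarrow> (real ^ 'p) set" where
  "nonneg_combinations V =
     {(\<Sum>v\<in>F. c v *\<^sub>R v) | F c. finite F \<and> F \<subseteq> V \<and> (\<forall>v\<in>F. 0 \<le> c v)}"

definition cone_points :: "(int ^ 'p) set \<Rightarrow> (int ^ 'p) set" where
  "cone_points S = {x \<in> nat_vecs. real_vec x \<in> nonneg_combinations (real_vec ` msg S)}"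

definition cone_le :: "(int ^ 'p) set \<Rightarrow> int ^ 'p \<Rightarrow> int ^ 'p \<Rightarrow> bool" where
  "cone_le S x y \<longleftrightarrow> y - x \<in> cone_points S"

definition Mult :: "(int ^ 'p) set \<Rightarrow> (int ^ 'p) set" where
  "Mult S = {x \<in> S - {0}. \<forall>y\<in>S - {0}. cone_le S y x \<longrightarrow> y = x}"

definition strong :: "(int ^ 'p) set \<Rightarrow> bool" where
  "strong S \<longleftrightarrow>
     (\<forall>x\<in>S - {0}. \<forall>y\<in>S - {0}. x \<noteq> y \<longrightarrow> (\<exists>e\<in>Mult S. x + y - e \<in> S))"

end

theory Submission
  imports Defs
begin

text \<open>For the converse, suppose that no \<open>x + y - e\<close> with \<open>e \<in> E\<close> lies in \<open>S\<close>. Then only generators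
  from \<open>A\<close> can be split off from \<open>x + y\<close>, and by the first condition never two distinct ones at
  once. So \<open>x\<close> and \<open>y\<close> are multiples of a single \<open>a \<in> A\<close>; being distinct and non-zero, they add up
  to at least \<open>3a\<close>, which contradicts the second condition.\<close>

lemma submonoid_hull_add:
  "x \<in> submonoid hull G \<Longrightarrow> y \<in> submonoid hull G \<Longrightarrow> x + y \<in> submonoid hull G"
  using submonoid_hull[of G] by (auto simp: submonoid_def)

lemma submonoid_hull_zero: "0 \<in> submonoid hull G"
  using submonoid_hull[of G] by (auto simp: submonoid_def)

lemma submonoid_hull_multiple:
  assumes "x \<in> submonoid hull G"
  shows "of_nat n *s x \<in> submonoid hull G"
proof (induction n)
  case 0
  then show ?case by (simp add: submonoid_hull_zero)
next
  case (Suc n)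
  have "of_nat (Suc n) *s x = x + of_nat n *s x"
    by (simp add: vec_eq_iff algebra_simps)
  with Suc assms show ?case by (metis submonoid_hull_add)
qed

text \<open>Induction over the hull: zero and the elements from which some generator splits off form
  a submonoid containing \<open>G\<close>, since a generator split off from \<open>x\<close> also
  splits off from \<open>x + y\<close>.\<close>

lemma submonoid_hull_split_generator:
  assumes "x \<in> submonoid hull G" "x \<noteq> 0"
  obtains g where "g \<in> G" "x - g \<in> submonoid hull G"
proof -
  let ?P = "\<lambda>x. x \<in> submonoid hull G \<and> (x = 0 \<or> (\<exists>g\<in>G. x - g \<in> submonoid hull G))"
  have "submonoid {x. ?P x}"
    unfolding submonoid_def[of "{x. ?P x}"]
  proof (intro conjI ballI)
    show "0 \<in> {x. ?P x}" by (simp add: submonoid_hull_zero)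
    fix x y assume xy: "x \<in> {x. ?P x}" "y \<in> {x. ?P x}"
    have "\<exists>g\<in>G. x + y - g \<in> submonoid hull G" if "g \<in> G" "x - g \<in> submonoid hull G" for g
      using that xy submonoid_hull_add[of "x - g" G y]
      by (auto simp: algebra_simps intro!: bexI[of _ g])
    then show "x + y \<in> {x. ?P x}"
      using xy by (cases "x = 0") (auto intro: submonoid_hull_add)
  qed
  moreover have "\<forall>x\<in>G. ?P x"
    using submonoid_hull_zero by (metis diff_self hull_inc)
  ultimately have "?P x"
    using assms(1) hull_induct[of x submonoid G ?P] by blast
  then show ?thesis using assms(2) that by blast
qed

text \<open>Whatever splits off from a summand splits off from the sum, so the hypothesis on
  \<open>a\<close> passes from \<open>x + y\<close> to \<open>x\<close> and to \<open>y\<close>. It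
  is therefore kept as the premise \<open>?Q\<close> inside the induction predicate.\<close>

lemma submonoid_hull_single_generator:
  assumes "x \<in> submonoid hull G"
    and "\<And>g. g \<in> G \<Longrightarrow> x - g \<in> submonoid hull G \<Longrightarrow> g = a"
  obtains n where "x = of_nat n *s a"
proof -
  let ?Q = "\<lambda>x. \<forall>g\<in>G. x - g \<in> submonoid hull G \<longrightarrow> g = a"
  let ?P = "\<lambda>x. x \<in> submonoid hull G \<and> (?Q x \<longrightarrow> (\<exists>n. x = of_nat n *s a))"
  have "submonoid {x. ?P x}"
    unfolding submonoid_def[of "{x. ?P x}"]
  proof (intro conjI ballI)
    have "0 = of_nat 0 *s a" by simp
    then show "0 \<in> {x. ?P x}" using submonoid_hull_zero by blast
    fix x y assume xy: "x \<in> {x. ?P x}" "y \<in> {x. ?P x}"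
    have "\<exists>n. x + y = of_nat n *s a" if Q: "?Q (x + y)"
    proof -
      have "?Q x"
        using Q xy submonoid_hull_add[of "x - _" G y] by (simp add: algebra_simps)
      moreover have "?Q y"
        using Q xy submonoid_hull_add[of x G "y - _"] by (simp add: algebra_simps)
      ultimately obtain m n where "x = of_nat m *s a" "y = of_nat n *s a"
        using xy by blast
      then have "x + y = of_nat (m + n) *s a"
        by (simp add: vec_eq_iff algebra_simps)
      then show ?thesis by blast
    qed
    then show "x + y \<in> {x. ?P x}"
      using xy by (auto intro: submonoid_hull_add)
  qed
  moreover have "?P x" if "x \<in> G" for x
  proof -
    have "\<exists>n. x = of_nat n *s a" if "?Q x"
    proof -
      \<comment> \<open>The generator \<open>x\<close> splits off from itself with remainder
        \<open>0\<close>, so \<open>?Q x\<close> forces it to be \<open>a\<close>.\<close>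
      have "x = a" using that \<open>x \<in> G\<close> submonoid_hull_zero[of G] by (metis diff_self)
      then have "x = of_nat 1 *s a" by simp
      then show ?thesis by blast
    qed
    then show ?thesis using that by (blast intro: hull_inc)
  qed
  ultimately have "?P x"
    using assms(1) hull_induct[of x submonoid G ?P] by blast
  then show ?thesis using assms(2) that by blast
qed

lemma submonoid_hull_msg:
  "affine_semigroup S \<Longrightarrow> submonoid hull (msg S) = S"
  using theI'[OF ex1_minimal_generating_set] unfolding msg_def minimal_generating_set_def by blast

text \<open>Dropping \<open>0\<close> from a generating set does not change its hull, so minimality
  excludes it. This makes the elements of \<open>A\<close> admissible in \<open>strong\<close>,
  which speaks of non-zero elements only.\<close>

lemma zero_notin_msg:
  assumes "affine_semigroup S"
  shows "0 \<notin> msg S"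
proof
  assume "0 \<in> msg S"
  then have "submonoid hull (msg S - {0}) \<noteq> S"
    using theI'[OF ex1_minimal_generating_set[OF assms]]
    unfolding msg_def minimal_generating_set_def by blast
  moreover have "msg S \<subseteq> submonoid hull (msg S - {0})"
    using submonoid_hull_zero by (blast intro: hull_inc)
  then have "submonoid hull (msg S) \<subseteq> submonoid hull (msg S - {0})"
    by (rule hull_minimal) (rule submonoid_hull)
  ultimately show False
    using hull_mono[of "msg S - {0}" "msg S" submonoid] submonoid_hull_msg[OF assms] by blast
qed

theorem proposition5:
  fixes S E A :: "(int ^ 'p) set"
  assumes "affine_semigroup S"
    and "E = Mult S"
    and "A = msg S - E"
  shows "strong S \<longleftrightarrow>
    (\<forall>a1\<in>A. \<forall>a2\<in>A. a1 \<noteq> a2 \<longrightarrow> (\<exists>e1\<in>E. a1 + a2 - e1 \<in> S)) \<and>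
    (\<forall>a1\<in>A. \<exists>e2\<in>E. 3 *s a1 - e2 \<in> S)"
proof -
  note hull = submonoid_hull_msg[OF assms(1)]
  have add: "x + y \<in> S" if "x \<in> S" "y \<in> S" for x y
    using that submonoid_hull_add[of x "msg S" y] hull by simp
  have zero: "0 \<in> S"
    using submonoid_hull_zero[of "msg S"] hull by simp
  have msgS: "a \<in> S" if "a \<in> msg S" for a
    using that hull_inc[of a "msg S" submonoid] hull by simp
  show ?thesis
  proof (intro iffI conjI ballI impI)
    assume strong: "strong S"
    fix a assume "a \<in> A"
    then have a: "a \<in> S" "a \<noteq> 0"
      using msgS zero_notin_msg[OF assms(1)] assms(3) by auto
    show "\<exists>e\<in>E. a + b - e \<in> S" if "b \<in> A" "a \<noteq> b" for b
      using a that msgS zero_notin_msg[OF assms(1)] strong assms(2,3)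
      by (auto simp: strong_def)
    \<comment> \<open>The triple condition is strongness applied to \<open>a\<close> and
      \<open>a + a\<close>; a non-zero coordinate of \<open>a\<close> shows that these are distinct
      and non-zero.\<close>
    obtain i where "a $ i \<noteq> 0"
      using a(2) by (metis vec_eq_iff zero_index)
    then have "(a + a) $ i \<noteq> 0" "(a + a) $ i \<noteq> a $ i" by auto
    then have "a + a \<noteq> 0" "a + a \<noteq> a" by (metis zero_index)+
    then obtain e where "e \<in> E" "a + (a + a) - e \<in> S"
      using strong add a assms(2) unfolding strong_def by (metis DiffI singletonD)
    moreover have "a + (a + a) = 3 *s a" by (simp add: vec_eq_iff)
    ultimately show "\<exists>e\<in>E. 3 *s a - e \<in> S" by auto
  next
    assume "(\<forall>a1\<in>A. \<forall>a2\<in>A. a1 \<noteq> a2 \<longrightarrow> (\<exists>e1\<in>E. a1 + a2 - e1 \<in> S)) \<and>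
      (\<forall>a1\<in>A. \<exists>e2\<in>E. 3 *s a1 - e2 \<in> S)"
    then have pair: "\<And>a b. a \<in> A \<Longrightarrow> b \<in> A \<Longrightarrow> a \<noteq> b \<Longrightarrow> \<exists>e\<in>E. a + b - e \<in> S"
      and triple: "\<And>a. a \<in> A \<Longrightarrow> \<exists>e\<in>E. 3 *s a - e \<in> S"
      by auto
    have "\<exists>e\<in>E. x + y - e \<in> S" if xy: "x \<in> S" "y \<in> S" "x \<noteq> 0" "y \<noteq> 0" "x \<noteq> y" for x y
    proof (rule ccontr)
      assume no: "\<not> (\<exists>e\<in>E. x + y - e \<in> S)"
      \<comment> \<open>Nothing in \<open>E\<close> splits off from a part \<open>s\<close> of
        \<open>x + y\<close>. This is used with \<open>s\<close> a single generator, a sum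
        \<open>a + g\<close>, and finally \<open>3 *s a\<close>.\<close>
      have not_E: False if "e \<in> E" "s - e \<in> S" "x + y - s \<in> S" for e s
        using add[OF that(2,3)] no that(1) by (auto simp: algebra_simps)
      obtain a where a: "a \<in> msg S" "x - a \<in> S"
        using submonoid_hull_split_generator[of x "msg S"] xy hull by auto
      have "x + y - a \<in> S"
        using add[OF a(2) xy(2)] by (simp add: algebra_simps)
      then have "a \<in> A"
        using a(1) not_E[of a a] zero assms(3) by auto
      \<comment> \<open>If \<open>g\<close> splits off from \<open>w\<close>, then
        \<open>a + g\<close> is a part of \<open>x + y\<close>, so \<open>g\<close> lies in
        \<open>A\<close> as well, and \<open>pair\<close> rules out
        \<open>g \<noteq> a\<close>.\<close>
      have multiple: "\<exists>n. w = of_nat n *s a" if w: "w \<in> S" "x + y - a - w \<in> S" for w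
      proof (rule submonoid_hull_single_generator[of w "msg S" a])
        show "w \<in> submonoid hull (msg S)" using w hull by simp
        show "g = a" if "g \<in> msg S" "w - g \<in> submonoid hull (msg S)" for g
        proof (rule ccontr)
          assume "g \<noteq> a"
          have rest: "x + y - (a + g) \<in> S"
            using add[OF w(2)] that(2) hull by (force simp: algebra_simps)
          then have "x + y - g \<in> S"
            using add[OF rest msgS[OF a(1)]] by (simp add: algebra_simps)
          then have "g \<in> A"
            using that(1) not_E[of g g] zero assms(3) by auto
          then show False
            using pair[OF \<open>a \<in> A\<close>] \<open>g \<noteq> a\<close> not_E rest by metis
        qed
      qed blast
      \<comment> \<open>Once \<open>a\<close> is removed, \<open>x - a\<close> and \<open>y\<close>
        are complementary parts of \<open>x + y - a\<close>, so \<open>multiple\<close> applies to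
        each.\<close>
      obtain m where m: "x - a = of_nat m *s a"
        using multiple[of "x - a"] a(2) xy(2) by auto
      obtain n where n: "y = of_nat n *s a"
        using multiple[of y] a(2) xy(2) by (auto simp: algebra_simps)
      have x: "x = of_nat (Suc m) *s a"
        using m by (simp add: vec_eq_iff algebra_simps)
      have "n \<noteq> 0" using n xy(4) by auto
      moreover have "n \<noteq> Suc m" using n x xy(5) by auto
      \<comment> \<open>\<open>Suc m\<close> and \<open>n\<close> are distinct and positive, so
        their sum is at least \<open>1 + 2\<close>.\<close>
      ultimately obtain k where "Suc m + n = 3 + k"
        using le_Suc_ex[of 3 "Suc m + n"] by force
      then have k: "int (Suc m) + int n = 3 + int k" by linarith
      have "x + y = (int (Suc m) + int n) *s a"
        using x n by (simp add: vec_eq_iff algebra_simps)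
      then have "x + y - 3 *s a = of_nat k *s a"
        unfolding k by (simp add: vec_eq_iff algebra_simps)
      then have "x + y - 3 *s a \<in> S"
        using submonoid_hull_multiple[of a "msg S" k] hull msgS[OF a(1)] by simp
      then show False
        using triple[OF \<open>a \<in> A\<close>] not_E by metis
    qed
    then show "strong S"
      using assms(2) by (auto simp: strong_def)
  qed
qed

end
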